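(* Let $R$ be a toric ring, generated over a field $k$ by monomials $t^{c_1},\dots,t^{c_n}$ in $k[t_1,\dots,t_m]$, and let $\mathfrak{I}$ be the toric ideal of $R$ in $k[X]=k[x_1,\dots,x_n]$. Let $<$ be the toric preorder of $k[X]$ with respect to $R$. Let $I$ be an arbitrary ideal of $k[X]$ which contains $\mathfrak{I}$. Then $L_<(I)\supseteq\mathfrak{I}$, and $L_<(I)/\mathfrak{I}$ is isomorphic (as a module over $k[X]/\mathfrak{I}\cong R$) to a monomial ideal of $R$.
   Context: A toric ring is a $k$-subalgebra $R$ of a polynomial ring $k[t_1,\dots,t_m]$ generated by monomials $t^{c_1},\dots,t^{c_n}$ with $c_1,\dots,c_n\in\mathbb{N}^m$. An ideal of $R$ is called a monomial ideal if it is generated by monomials of $k[t_1,\dots,t_m]$. Let $\phi:k[X]\to R$ be the $k$-algebra map with $x_i\mapsto t^{c_i}$; the toric ideal of $R$ is $\mathfrak{I}=\ker\phi$, so $R\cong k[X]/\mathfrak{I}$. Let $M$ be the $m\times n$ matrix with columns $c_1,\dots,c_n$. The toric preorder associated to $R$ is the relation on monomials of $k[X]$ given by $x^a<x^b$ if and only if $M\cdot a<_{\mathrm{lex}}M\cdot b$, where $<_{\mathrm{lex}}$ is the lexicographic order on $\mathbb{R}^m$. For $f=\sum c_ax^a\in k[X]$, the leading part $L_<(f)$ is the sum of those terms $c_ax^a$ (with $c_a\neq0$) for which there is no monomial $x^b$ occurring in $f$ with $x^a<x^b$. For a subset $G\subseteq k[X]$, the leading ideal $L_<(G)$ is the ideal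 of $k[X]$ generated by all $L_<(f)$, $f\in G$. *)

theory Defs
  imports
    "HOL-Library.Poly_Mapping"
    "HOL-Algebra.QuotRing"
    "HOL-Algebra.Generated_Rings"
    "HOL-Algebra.Module"
begin

section \<open>Polynomial rings and toric rings\<close>

text \<open>An exponent vector is a finitely supported function on the indices \<open>0, 1, 2, \<dots>\<close>; a polynomial
  is a finitely supported function from exponent vectors to coefficients, multiplied by convolution.
  Indices are shifted by one: \<open>x\<^sub>1, \<dots>, x\<^sub>n\<close> have the indices \<open>0, \<dots>, n - 1\<close>.\<close>

type_synonym expo = "nat \<Rightarrow>\<^sub>0 nat"
type_synonym 'k mpol = "expo \<Rightarrow>\<^sub>0 'k"

definition term_of :: "'k::field \<Rightarrow> expo \<Rightarrow> 'k mpol" where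
  "term_of r a = Poly_Mapping.single a r"

definition const_of :: "'k::field \<Rightarrow> 'k mpol" where
  "const_of r = term_of r 0"

definition monomial_of :: "expo \<Rightarrow> 'k::field mpol" where
  "monomial_of a = term_of 1 a"

definition poly_ring :: "nat \<Rightarrow> 'k::field mpol ring" where
  "poly_ring n = \<lparr>carrier = {p. \<forall>a\<in>Poly_Mapping.keys p. Poly_Mapping.keys a \<subseteq> {..<n}},
     mult = (*), one = 1, zero = 0, add = (+)\<rparr>"

text \<open>The subalgebra generated by the given monomials is the subring generated by these monomials
  together with the constants.\<close>

definition toric_ring :: "nat \<Rightarrow> nat \<Rightarrow> (nat \<Rightarrow> expo) \<Rightarrow> 'k::field mpol ring" where
  "toric_ring m n c = (poly_ring m)\<lparr>carrier :=
     generate_ring (poly_ring m) (const_of ` UNIV \<union> (\<lambda>j. monomial_of (c j)) ` {..<n})\<rparr>"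

definition monomial_ideal :: "'k::field mpol ring \<Rightarrow> 'k mpol set \<Rightarrow> bool" where
  "monomial_ideal R J \<longleftrightarrow> ideal J R \<and>
     (\<exists>S. S \<subseteq> carrier R \<and> S \<subseteq> monomial_of ` UNIV \<and> J = Idl\<^bsub>R\<^esub> S)"

text \<open>Substitution of the monomial with exponent \<open>c j\<close> for \<open>x\<close> with index \<open>j\<close>.\<close>

definition toric_map :: "nat \<Rightarrow> (nat \<Rightarrow> expo) \<Rightarrow> 'k::field mpol \<Rightarrow> 'k mpol" where
  "toric_map n c f = (\<Sum>a\<in>Poly_Mapping.keys f. const_of (Poly_Mapping.lookup f a) *
     (\<Prod>j<n. monomial_of (c j) ^ Poly_Mapping.lookup a j))"

definition toric_ideal :: "nat \<Rightarrow> nat \<Rightarrow> (nat \<Rightarrow> expo) \<Rightarrow> 'k::field mpol set" where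
  "toric_ideal m n c = a_kernel (poly_ring n) (toric_ring m n c) (toric_map n c)"

text \<open>The map \<open>k[X]/\<II> \<rightarrow> R\<close> induced by the substitution map: it sends a coset to the common value of
  its elements.\<close>

definition induced_map :: "nat \<Rightarrow> (nat \<Rightarrow> expo) \<Rightarrow> 'k::field mpol set \<Rightarrow> 'k mpol" where
  "induced_map n c C = the_elem (toric_map n c ` C)"


section \<open>Toric preorder and leading ideals\<close>

text \<open>The first \<open>m\<close> entries of \<open>M \<cdot> a\<close>, where \<open>M\<close> has the columns \<open>c 0, \<dots>, c (n - 1)\<close>.\<close>

definition toric_weight :: "nat \<Rightarrow> (nat \<Rightarrow> expo) \<Rightarrow> expo \<Rightarrow> nat \<Rightarrow> real" where
  "toric_weight n c a i =
     (\<Sum>j<n. real (Poly_Mapping.lookup (c j) i) * real (Poly_Mapping.lookup a j))"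

definition lex_less :: "nat \<Rightarrow> (nat \<Rightarrow> real) \<Rightarrow> (nat \<Rightarrow> real) \<Rightarrow> bool" where
  "lex_less m u v \<longleftrightarrow> (\<exists>i<m. u i < v i \<and> (\<forall>j<i. u j = v j))"

definition toric_less :: "nat \<Rightarrow> nat \<Rightarrow> (nat \<Rightarrow> expo) \<Rightarrow> expo \<Rightarrow> expo \<Rightarrow> bool" where
  "toric_less m n c a b \<longleftrightarrow> lex_less m (toric_weight n c a) (toric_weight n c b)"

definition leading_part :: "(expo \<Rightarrow> expo \<Rightarrow> bool) \<Rightarrow> 'k::field mpol \<Rightarrow> 'k mpol" where
  "leading_part prec f =
     (\<Sum>a | a \<in> Poly_Mapping.keys f \<and> (\<forall>b\<in>Poly_Mapping.keys f. \<not> prec a b).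
        term_of (Poly_Mapping.lookup f a) a)"

definition leading_ideal :: "(expo \<Rightarrow> expo \<Rightarrow> bool) \<Rightarrow> nat \<Rightarrow> 'k::field mpol set \<Rightarrow> 'k mpol set" where
  "leading_ideal prec n G = Idl\<^bsub>poly_ring n\<^esub> (leading_part prec ` G)"


section \<open>Modules\<close>

text \<open>The multiplication and unit fields of a module record play no role in the locale
  \<^locale>\<open>module\<close>.\<close>

definition ideal_module :: "('a, 'b) ring_scheme \<Rightarrow> 'a set \<Rightarrow> ('a, 'a) module" where
  "ideal_module R J = \<lparr>carrier = J, mult = mult R, one = one R, zero = zero R, add = add R,
     smult = mult R\<rparr>"

definition restrict_scalars :: "('r \<Rightarrow> 's) \<Rightarrow> ('s, 'a) module \<Rightarrow> ('r, 'a) module" where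
  "restrict_scalars \<psi> N = \<lparr>carrier = carrier N, mult = mult N, one = one N, zero = zero N,
     add = add N, smult = (\<lambda>r x. \<psi> r \<odot>\<^bsub>N\<^esub> x)\<rparr>"

text \<open>For an ideal \<open>L \<supseteq> A\<close> of \<open>P\<close>, the quotient \<open>L/A\<close> is an ideal of \<open>P/A\<close>, hence a
  \<open>P/A\<close>-module.\<close>

definition quotient_module :: "('a, 'b) ring_scheme \<Rightarrow> 'a set \<Rightarrow> 'a set \<Rightarrow> ('a set, 'a set) module"
  where "quotient_module P A L = ideal_module (P Quot A) ((\<lambda>f. A +>\<^bsub>P\<^esub> f) ` L)"

definition module_iso :: "('r, 'x) ring_scheme \<Rightarrow> ('r, 'a) module \<Rightarrow> ('r, 'b) module \<Rightarrow> ('a \<Rightarrow> 'b) set"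
  where "module_iso R M N = {h. bij_betw h (carrier M) (carrier N) \<and>
     (\<forall>x\<in>carrier M. \<forall>y\<in>carrier M. h (x \<oplus>\<^bsub>M\<^esub> y) = h x \<oplus>\<^bsub>N\<^esub> h y) \<and>
     (\<forall>r\<in>carrier R. \<forall>x\<in>carrier M. h (r \<odot>\<^bsub>M\<^esub> x) = r \<odot>\<^bsub>N\<^esub> h x)}"

definition is_module_iso :: "('r, 'x) ring_scheme \<Rightarrow> ('r, 'a) module \<Rightarrow> ('r, 'b) module \<Rightarrow> bool"
  where "is_module_iso R M N \<longleftrightarrow> module R M \<and> module R N \<and> module_iso R M N \<noteq> {}"

end

theory Submission
  imports Defs
begin

text \<open>Give \<open>x\<^sup>a\<close> the degree \<open>M a\<close>. The substitution map \<open>\<phi>\<close> sends the component of degree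
  \<open>d\<close> of \<open>f\<close> to the term of \<open>\<phi> f\<close> with exponent \<open>d\<close>. Hence the components of a
  polynomial in \<open>\<II>\<close> are again in \<open>\<II>\<close>, and each of them is its own leading part, since
  \<open><\<close> compares degrees only; this gives \<open>\<II> \<subseteq> L(I)\<close>. As the lexicographic order is total,
  a leading part is homogeneous, so \<open>\<phi>\<close> sends it to a scalar multiple of a single monomial.
  Therefore \<open>J = \<phi> (L(I))\<close> is generated by the monomials that it contains, and \<open>\<phi>\<close> induces
  \<open>L(I)/\<II> \<cong> J\<close>.\<close>

section \<open>Ideals as modules\<close>

lemma ideal_module_is_module:
  assumes "cring R" "ideal J R"
  shows "module R (ideal_module R J)"
proof -
  interpret cring R by fact
  interpret J: ideal J R by fact
  have "abelian_group (ideal_module R J)"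
  proof (rule abelian_groupI)
    fix x assume "x \<in> carrier (ideal_module R J)"
    then have "x \<in> J" by (simp add: ideal_module_def)
    then show "\<exists>y\<in>carrier (ideal_module R J). y \<oplus>\<^bsub>ideal_module R J\<^esub> x = \<zero>\<^bsub>ideal_module R J\<^esub>"
      by (intro bexI[of _ "\<ominus>\<^bsub>R\<^esub> x"]) (auto simp: ideal_module_def l_neg)
  qed (auto simp: ideal_module_def a_ac)
  then show ?thesis
    by (intro moduleI is_cring)
      (auto simp: ideal_module_def J.I_l_closed l_distr r_distr m_assoc)
qed

lemma restrict_scalars_is_module:
  assumes "module S N" "cring R" "\<psi> \<in> ring_hom R S"
  shows "module R (restrict_scalars \<psi> N)"
proof -
  interpret module S N by fact
  interpret Q: cring R by fact
  note hom = ring_hom_memE[OF assms(3)]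
  have "abelian_group (restrict_scalars \<psi> N)"
  proof (rule abelian_groupI)
    fix x assume "x \<in> carrier (restrict_scalars \<psi> N)"
    then have "x \<in> carrier N" by (simp add: restrict_scalars_def)
    then show "\<exists>y\<in>carrier (restrict_scalars \<psi> N).
        y \<oplus>\<^bsub>restrict_scalars \<psi> N\<^esub> x = \<zero>\<^bsub>restrict_scalars \<psi> N\<^esub>"
      by (intro bexI[of _ "\<ominus>\<^bsub>N\<^esub> x"]) (auto simp: restrict_scalars_def M.l_neg)
  qed (auto simp: restrict_scalars_def M.a_ac)
  then show ?thesis
    by (intro moduleI assms(2))
      (auto simp: restrict_scalars_def hom smult_l_distr smult_r_distr smult_assoc1)
qed

section \<open>Images of ideals and the first isomorphism theorem for modules\<close>

context ring_hom_ring
begin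

text \<open>Surjectivity enters in the absorption property: a multiplier from \<open>S\<close> has
  to be lifted to \<open>R\<close> before the ideal property of \<open>L\<close> can be
  applied.\<close>

lemma ideal_image:
  assumes "ideal L R" "h ` carrier R = carrier S"
  shows "ideal (h ` L) S"
proof -
  interpret L: ideal L R by fact
  show ?thesis
  proof (rule idealI[OF S.ring_axioms])
    show "subgroup (h ` L) (add_monoid S)"
    proof (rule S.add.subgroupI)
      show "h ` L \<subseteq> carrier S" using L.a_subset by auto
      show "h ` L \<noteq> {}" using additive_subgroup.zero_closed[OF L.additive_subgroup_axioms] by blast
      fix a assume "a \<in> h ` L"
      then obtain x where "x \<in> L" "a = h x" by auto
      then have "\<ominus>\<^bsub>S\<^esub> a = h (\<ominus> x)" "\<ominus> x \<in> L"
        using L.Icarr by auto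
      then show "\<ominus>\<^bsub>S\<^esub> a \<in> h ` L" by auto
      fix b assume "b \<in> h ` L"
      then obtain y where "y \<in> L" "b = h y" by auto
      then have "a \<oplus>\<^bsub>S\<^esub> b = h (x \<oplus> y)" "x \<oplus> y \<in> L"
        using L.Icarr \<open>x \<in> L\<close> \<open>a = h x\<close> by auto
      then show "a \<oplus>\<^bsub>S\<^esub> b \<in> h ` L" by auto
    qed
  next
    fix a y assume "a \<in> h ` L" "y \<in> carrier S"
    then obtain x z where xz: "x \<in> L" "a = h x" "z \<in> carrier R" "y = h z"
      using assms(2) by (metis imageE)
    then have "y \<otimes>\<^bsub>S\<^esub> a = h (z \<otimes> x)" "a \<otimes>\<^bsub>S\<^esub> y = h (x \<otimes> z)" using L.Icarr by auto
    then show "y \<otimes>\<^bsub>S\<^esub> a \<in> h ` L" "a \<otimes>\<^bsub>S\<^esub> y \<in> h ` L"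
      using xz(1,3) L.I_l_closed L.I_r_closed by (metis imageI)+
  qed
qed

lemma quotient_module_iso_image:
  assumes "cring R" "cring S" and surj: "h ` carrier R = carrier S"
    and L: "ideal L R"
  shows "is_module_iso (R Quot a_kernel R S h) (quotient_module R (a_kernel R S h) L)
    (restrict_scalars (\<lambda>X. the_elem (h ` X)) (ideal_module S (h ` L)))"
proof -
  let ?A = "a_kernel R S h" and ?\<psi> = "\<lambda>X. the_elem (h ` X)"
  interpret L: ideal L R by fact
  interpret A: ideal ?A R by (rule kernel_is_ideal)
  have Q: "cring (R Quot ?A)" by (rule A.quotient_is_cring[OF assms(1)])
  have QL: "ideal ((+>) ?A ` L) (R Quot ?A)"
    by (rule R.ring_ideal_imp_quot_ideal[OF kernel_is_ideal L])
  have \<psi>: "?\<psi> \<in> ring_iso (R Quot ?A) S" by (rule FactRing_iso_set[OF surj])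
  then have hom: "?\<psi> \<in> ring_hom (R Quot ?A) S" and inj: "inj_on ?\<psi> (carrier (R Quot ?A))"
    by (auto simp: ring_iso_def bij_betw_def)
  have sub: "(+>) ?A ` L \<subseteq> carrier (R Quot ?A)"
    using ideal.Icarr[OF QL] by blast
  \<comment> \<open>\<open>h\<close> is constant on each coset of its kernel, so
    \<open>?\<psi>\<close> sends the coset of \<open>x\<close> to \<open>h x\<close>.\<close>
  have "?\<psi> ` ((+>) ?A ` L) = h ` L"
    unfolding image_image using L.Icarr by (intro image_cong) auto
  then have bij: "bij_betw ?\<psi> ((+>) ?A ` L) (h ` L)"
    using inj_on_subset[OF inj sub] by (simp add: bij_betw_def)
  have "module (R Quot ?A) (quotient_module R ?A L)"
    unfolding quotient_module_def by (rule ideal_module_is_module[OF Q QL])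
  moreover have "module (R Quot ?A) (restrict_scalars ?\<psi> (ideal_module S (h ` L)))"
    by (rule restrict_scalars_is_module[OF _ Q hom])
      (rule ideal_module_is_module[OF assms(2) ideal_image[OF L surj]])
  moreover have "?\<psi> \<in> module_iso (R Quot ?A) (quotient_module R ?A L)
      (restrict_scalars ?\<psi> (ideal_module S (h ` L)))"
    using bij sub ring_hom_add[OF hom] ring_hom_mult[OF hom]
    unfolding module_iso_def quotient_module_def restrict_scalars_def ideal_module_def
    by (auto simp: subset_iff)
  ultimately show ?thesis unfolding is_module_iso_def by blast
qed

end


section \<open>Polynomial rings\<close>

lemma poly_ring_cring: "cring (poly_ring n :: 'k::field mpol ring)"
proof (rule cringI)
  let ?P = "poly_ring n :: 'k mpol ring"
  show "abelian_group ?P"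
  proof (rule abelian_groupI)
    fix p q assume "p \<in> carrier ?P" "q \<in> carrier ?P"
    then show "p \<oplus>\<^bsub>?P\<^esub> q \<in> carrier ?P"
      using keys_add[of p q] by (auto simp: poly_ring_def)
  next
    fix p assume "p \<in> carrier ?P"
    then show "\<exists>q\<in>carrier ?P. q \<oplus>\<^bsub>?P\<^esub> p = \<zero>\<^bsub>?P\<^esub>"
      by (intro bexI[of _ "- p"]) (auto simp: poly_ring_def)
  qed (auto simp: poly_ring_def algebra_simps)
  show "comm_monoid ?P"
  proof (rule comm_monoidI)
    fix p q assume *: "p \<in> carrier ?P" "q \<in> carrier ?P"
    have "Poly_Mapping.keys c \<subseteq> {..<n}" if "c \<in> Poly_Mapping.keys (p * q)" for c
    proof -
      obtain a b where "a \<in> Poly_Mapping.keys p" "b \<in> Poly_Mapping.keys q" "c = a + b"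
        using keys_mult[of p q] \<open>c \<in> _\<close> by blast
      then show ?thesis using * keys_add[of a b] by (fastforce simp: poly_ring_def)
    qed
    then show "p \<otimes>\<^bsub>?P\<^esub> q \<in> carrier ?P" by (auto simp: poly_ring_def)
  qed (auto simp: poly_ring_def algebra_simps)
qed (auto simp: poly_ring_def algebra_simps)

lemma poly_ring_simps [simp]:
  "mult (poly_ring n) = (*)" "one (poly_ring n) = 1" "zero (poly_ring n) = 0"
  "add (poly_ring n) = (+)"
  by (simp_all add: poly_ring_def)

lemma carrier_poly_ring_iff:
  "f \<in> carrier (poly_ring n) \<longleftrightarrow>
    (\<forall>a\<in>Poly_Mapping.keys f. Poly_Mapping.keys a \<subseteq> {..<n})"
  by (simp add: poly_ring_def)

lemma sum_mem_ideal:
  assumes "ideal L (poly_ring n)" "\<And>x. x \<in> A \<Longrightarrow> F x \<in> L"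
  shows "sum F A \<in> L"
proof -
  interpret L: ideal L "poly_ring n" by fact
  show ?thesis using assms(2) additive_subgroup.zero_closed[OF L.additive_subgroup_axioms]
      additive_subgroup.a_closed[OF L.additive_subgroup_axioms]
    by (induction A rule: infinite_finite_induct) auto
qed

text \<open>A common form for two constructions: leading parts, where \<open>P\<close> is maximality
  among the exponents of \<open>f\<close>, and homogeneous components, where \<open>P\<close>
  prescribes the degree.\<close>

definition mpol_part :: "(expo \<Rightarrow> bool) \<Rightarrow> 'k::field mpol \<Rightarrow> 'k mpol" where
  "mpol_part P f =
    (\<Sum>a | a \<in> Poly_Mapping.keys f \<and> P a. term_of (Poly_Mapping.lookup f a) a)"

lemma lookup_mpol_part:
  "Poly_Mapping.lookup (mpol_part P f) a = (if P a then Poly_Mapping.lookup f a else 0)"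
  by (auto simp: mpol_part_def term_of_def lookup_sum lookup_single when_def
      sum.delta in_keys_iff)

lemma keys_mpol_part:
  "Poly_Mapping.keys (mpol_part P f) = {a \<in> Poly_Mapping.keys f. P a}"
  by (auto simp: in_keys_iff lookup_mpol_part split: if_splits)

lemma mpol_part_carrier:
  "f \<in> carrier (poly_ring n) \<Longrightarrow> mpol_part P f \<in> carrier (poly_ring n)"
  by (simp add: carrier_poly_ring_iff keys_mpol_part)

lemma mpol_part_id:
  "(\<And>a. a \<in> Poly_Mapping.keys f \<Longrightarrow> P a) \<Longrightarrow> mpol_part P f = f"
  by (rule poly_mapping_eqI) (auto simp: lookup_mpol_part in_keys_iff)

lemma leading_part_eq_mpol_part:
  "leading_part prec f = mpol_part (\<lambda>a. \<forall>b\<in>Poly_Mapping.keys f. \<not> prec a b) f"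
  by (simp add: leading_part_def mpol_part_def)

lemma mpol_sum_terms:
  "(\<Sum>a\<in>Poly_Mapping.keys f. Poly_Mapping.single a (Poly_Mapping.lookup f a)) = (f :: 'k::field mpol)"
  using mpol_part_id[of f "\<lambda>_. True"] by (simp add: mpol_part_def term_of_def)

text \<open>The coefficient at \<open>a\<close> receives a contribution only from
  \<open>d = T a\<close>. If this \<open>d\<close> is not a summation index, then \<open>a\<close>
  does not occur in \<open>f\<close> and both coefficients vanish.\<close>

lemma sum_mpol_part_fibres:
  "(\<Sum>d\<in>T ` Poly_Mapping.keys f. mpol_part (\<lambda>a. T a = d) f) = f"
proof (rule poly_mapping_eqI)
  fix a
  have "(\<Sum>d\<in>T ` Poly_Mapping.keys f. if T a = d then Poly_Mapping.lookup f a else 0)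
      = Poly_Mapping.lookup f a"
    by (auto simp: sum.delta in_keys_iff)
  then show "Poly_Mapping.lookup (\<Sum>d\<in>T ` Poly_Mapping.keys f. mpol_part (\<lambda>a. T a = d) f) a
      = Poly_Mapping.lookup f a"
    by (simp add: lookup_sum lookup_mpol_part)
qed

lemma single_sum:
  "Poly_Mapping.single d (sum F A) = (\<Sum>a\<in>A. Poly_Mapping.single d (F a))"
  by (induction A rule: infinite_finite_induct) (auto simp: single_add)


section \<open>The substitution map\<close>

text \<open>The matrix product \<open>M a\<close> as an exponent vector. The multiple of
  \<open>c j\<close> is written as an iterated sum because multiplying out the powers of monomials
  in \<open>toric_map\<close> yields exactly this form.\<close>

definition toric_expo :: "nat \<Rightarrow> (nat \<Rightarrow> expo) \<Rightarrow> expo \<Rightarrow> expo" where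
  "toric_expo n c a = (\<Sum>j<n. \<Sum>i<Poly_Mapping.lookup a j. c j)"

lemma lookup_toric_expo:
  "Poly_Mapping.lookup (toric_expo n c a) i =
    (\<Sum>j<n. Poly_Mapping.lookup (c j) i * Poly_Mapping.lookup a j)"
  unfolding toric_expo_def lookup_sum by (simp add: mult.commute)

lemma toric_expo_add: "toric_expo n c (a + b) = toric_expo n c a + toric_expo n c b"
  by (rule poly_mapping_eqI)
    (simp add: lookup_toric_expo lookup_add distrib_left sum.distrib)

lemma toric_expo_0: "toric_expo n c 0 = 0"
  by (simp add: toric_expo_def)

lemma toric_expo_single:
  "j < n \<Longrightarrow> toric_expo n c (Poly_Mapping.single j 1) = c j"
  by (rule poly_mapping_eqI)
    (simp add: lookup_toric_expo lookup_single when_def if_distrib cong: if_cong)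

lemma keys_toric_expo:
  assumes "\<And>j. j < n \<Longrightarrow> Poly_Mapping.keys (c j) \<subseteq> {..<m}"
  shows "Poly_Mapping.keys (toric_expo n c a) \<subseteq> {..<m}"
proof
  fix i assume "i \<in> Poly_Mapping.keys (toric_expo n c a)"
  then obtain j where "j < n" "Poly_Mapping.lookup (c j) i \<noteq> 0"
    by (auto simp: in_keys_iff lookup_toric_expo)
  then show "i \<in> {..<m}" using assms by (auto simp: in_keys_iff subset_iff)
qed

section \<open>Comparison of degrees by the toric preorder\<close>

lemma toric_weight_eq: "toric_weight n c a i = real (Poly_Mapping.lookup (toric_expo n c a) i)"
  by (simp add: toric_weight_def lookup_toric_expo)

text \<open>Strong induction: once all earlier entries agree, a difference at \<open>i\<close> would
  decide the lexicographic comparison in one direction.\<close>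

lemma lex_less_total:
  assumes "\<not> lex_less m u v" "\<not> lex_less m v u" "i < m"
  shows "u i = v i"
  using assms(3)
proof (induction i rule: less_induct)
  case (less i)
  then have "\<forall>j<i. u j = v j" by simp
  with assms less.prems show ?case unfolding lex_less_def by (metis linorder_neqE)
qed

text \<open>Totality of the lexicographic order settles the first \<open>m\<close> entries. Beyond
  them both degrees vanish, since the \<open>c j\<close> involve only the indices below
  \<open>m\<close>.\<close>

lemma toric_expo_eq_if_not_less:
  assumes "\<And>j. j < n \<Longrightarrow> Poly_Mapping.keys (c j) \<subseteq> {..<m}"
    and "\<not> toric_less m n c a b" "\<not> toric_less m n c b a"
  shows "toric_expo n c a = toric_expo n c b"
proof (rule poly_mapping_eqI)
  fix i
  show "Poly_Mapping.lookup (toric_expo n c a) i = Poly_Mapping.lookup (toric_expo n c b) i"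
  proof (cases "i < m")
    case True
    then show ?thesis
      using lex_less_total[OF assms(2,3)[unfolded toric_less_def]] by (simp add: toric_weight_eq)
  next
    case False
    then have "i \<notin> Poly_Mapping.keys (toric_expo n c a)" "i \<notin> Poly_Mapping.keys (toric_expo n c b)"
      using keys_toric_expo[of n c m, OF assms(1)] by blast+
    then show ?thesis by (simp add: in_keys_iff)
  qed
qed

lemma not_toric_less_if_toric_expo_eq:
  "toric_expo n c a = toric_expo n c b \<Longrightarrow> \<not> toric_less m n c a b"
  by (simp add: toric_less_def lex_less_def toric_weight_eq)

section \<open>Substitution as a graded ring homomorphism\<close>

lemma monomial_of_power:
  "(monomial_of a ^ k :: 'k::field mpol) = monomial_of (\<Sum>i<k. a)"
  \<comment> \<open>\<open>sum_constant\<close> is switched off so that the sum of \<open>k\<close>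
    copies of \<open>a\<close> stays a sum and gains one copy in the induction step.\<close>
  by (induction k)
    (simp_all add: monomial_of_def term_of_def mult_single add.commute del: sum_constant)

lemma prod_monomial_of:
  "(\<Prod>j\<in>A. monomial_of (F j) :: 'k::field mpol) = monomial_of (sum F A)"
  by (induction A rule: infinite_finite_induct)
    (simp_all add: monomial_of_def term_of_def mult_single)

text \<open>Collecting the powers into one monomial turns substitution into a change of exponents.
  Exponents in \<open>A\<close> outside the support contribute zero.\<close>

lemma toric_map_altdef:
  assumes "finite A" "Poly_Mapping.keys f \<subseteq> A"
  shows "toric_map n c f =
    (\<Sum>a\<in>A. Poly_Mapping.single (toric_expo n c a) (Poly_Mapping.lookup f a))"
proof -
  have "toric_map n c f = (\<Sum>a\<in>Poly_Mapping.keys f.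
      Poly_Mapping.single (toric_expo n c a) (Poly_Mapping.lookup f a))"
    unfolding toric_map_def monomial_of_power prod_monomial_of toric_expo_def[symmetric]
    by (simp add: monomial_of_def const_of_def term_of_def mult_single)
  also have "\<dots> = (\<Sum>a\<in>A. Poly_Mapping.single (toric_expo n c a) (Poly_Mapping.lookup f a))"
    using assms by (intro sum.mono_neutral_left) (auto simp: in_keys_iff)
  finally show ?thesis .
qed

lemma toric_map_single:
  "toric_map n c (Poly_Mapping.single a r) = Poly_Mapping.single (toric_expo n c a) r"
  by (subst toric_map_altdef[of "{a}"]) auto

lemma toric_map_0: "toric_map n c 0 = 0"
  by (simp add: toric_map_def)

lemma toric_map_add: "toric_map n c (f + g) = toric_map n c f + toric_map n c g"
proof -
  \<comment> \<open>Cancellation may shrink the support of \<open>f + g\<close>, so all three sums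
    are taken over this common set.\<close>
  let ?A = "Poly_Mapping.keys f \<union> Poly_Mapping.keys g"
  have *: "toric_map n c h =
      (\<Sum>a\<in>?A. Poly_Mapping.single (toric_expo n c a) (Poly_Mapping.lookup h a))"
    if "Poly_Mapping.keys h \<subseteq> ?A" for h
    using that by (intro toric_map_altdef) auto
  show ?thesis
    using *[of f] *[of g] *[OF keys_add]
    by (simp add: lookup_add single_add sum.distrib)
qed

lemma toric_map_sum: "toric_map n c (sum F A) = (\<Sum>x\<in>A. toric_map n c (F x))"
  by (induction A rule: infinite_finite_induct) (simp_all add: toric_map_0 toric_map_add)

text \<open>Expanding both factors into terms reduces the claim to single terms, where it is the
  additivity of \<open>toric_expo\<close>.\<close>

lemma toric_map_mult: "toric_map n c (f * g) = toric_map n c f * toric_map n c g"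
proof -
  let ?t = "\<lambda>f a. Poly_Mapping.single a (Poly_Mapping.lookup f a)"
  have "f * g = (\<Sum>a\<in>Poly_Mapping.keys f. \<Sum>b\<in>Poly_Mapping.keys g. ?t f a * ?t g b)"
    unfolding sum_product[symmetric] mpol_sum_terms ..
  then have "toric_map n c (f * g) = (\<Sum>a\<in>Poly_Mapping.keys f. \<Sum>b\<in>Poly_Mapping.keys g.
      toric_map n c (?t f a) * toric_map n c (?t g b))"
    by (simp add: toric_map_sum mult_single toric_map_single toric_expo_add)
  also have "\<dots> = toric_map n c f * toric_map n c g"
    unfolding sum_product[symmetric] toric_map_sum[symmetric] mpol_sum_terms ..
  finally show ?thesis .
qed

text \<open>On both sides the coefficient at \<open>d\<close> is the sum of the coefficients of
  \<open>f\<close> over all exponents of degree \<open>d\<close>.\<close>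

lemma toric_map_fibre:
  "toric_map n c (mpol_part (\<lambda>a. toric_expo n c a = d) f) =
    Poly_Mapping.single d (Poly_Mapping.lookup (toric_map n c f) d)"
proof -
  let ?K = "Poly_Mapping.keys f"
  \<comment> \<open>Outside the fibre the coefficient is zero, so the exponent may be written as
    \<open>d\<close> in every summand.\<close>
  have "toric_map n c (mpol_part (\<lambda>a. toric_expo n c a = d) f) =
      (\<Sum>a\<in>?K. Poly_Mapping.single d (Poly_Mapping.lookup f a when toric_expo n c a = d))"
    by (subst toric_map_altdef[of ?K])
      (auto simp: keys_mpol_part lookup_mpol_part when_def intro!: sum.cong)
  also have "\<dots> = Poly_Mapping.single d (Poly_Mapping.lookup (toric_map n c f) d)"
    by (simp add: toric_map_altdef[OF finite_keys order_refl, of n c f] lookup_sum lookup_single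
        single_sum)
  finally show ?thesis .
qed


section \<open>Toric rings\<close>

context
  fixes m n :: nat and c :: "nat \<Rightarrow> expo"
  assumes keys_c: "\<And>j. j < n \<Longrightarrow> Poly_Mapping.keys (c j) \<subseteq> {..<m}"
begin

lemma toric_map_hom_poly_ring:
  "toric_map n c \<in> ring_hom (poly_ring n) (poly_ring m :: 'k::field mpol ring)"
proof (rule ring_hom_memI)
  fix f :: "'k mpol"
  have "Poly_Mapping.keys (toric_map n c f) \<subseteq> toric_expo n c ` Poly_Mapping.keys f"
    using keys_sum[of "\<lambda>a. Poly_Mapping.single (toric_expo n c a) (Poly_Mapping.lookup f a)"
        "Poly_Mapping.keys f"]
    by (auto simp: toric_map_altdef[OF finite_keys order_refl, of n c f] split: if_splits)
  then show "toric_map n c f \<in> carrier (poly_ring m)"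
    using keys_toric_expo[of n c m, OF keys_c] by (fastforce simp: carrier_poly_ring_iff)
next
  show "toric_map n c \<one>\<^bsub>poly_ring n\<^esub> = (\<one>\<^bsub>poly_ring m\<^esub> :: 'k mpol)"
    using toric_map_single[of n c 0 "1::'k"] by (simp add: toric_expo_0)
qed (simp_all add: toric_map_add toric_map_mult)

abbreviation toric_gens :: "'k::field mpol set" where
  "toric_gens \<equiv> const_of ` UNIV \<union> (\<lambda>j. monomial_of (c j)) ` {..<n}"

lemma toric_gens_carrier: "toric_gens \<subseteq> carrier (poly_ring m)"
  using keys_c
  by (fastforce simp: carrier_poly_ring_iff const_of_def monomial_of_def term_of_def)

lemma subring_toric_gens:
  "subring (generate_ring (poly_ring m) toric_gens) (poly_ring m :: 'k::field mpol ring)"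
  by (rule ring.generate_ring_is_subring[OF cring.axioms(1)[OF poly_ring_cring] toric_gens_carrier])

lemma toric_ring_cring: "cring (toric_ring m n c :: 'k::field mpol ring)"
proof -
  interpret cring "poly_ring m :: 'k mpol ring" by (rule poly_ring_cring)
  show ?thesis
    using subcring_iff subcringI'[OF subring_toric_gens] subringE(1)[OF subring_toric_gens]
    unfolding toric_ring_def by blast
qed

text \<open>The image is a subring containing the generators, hence contains the ring they generate.
  Conversely, \<open>toric_map n c f\<close> is assembled from generators by powers, products and
  sums.\<close>

lemma toric_map_image:
  "toric_map n c ` carrier (poly_ring n) = carrier (toric_ring m n c :: 'k::field mpol ring)"
proof -
  let ?G = "generate_ring (poly_ring m) (toric_gens :: 'k mpol set)"
  interpret P: cring "poly_ring n :: 'k mpol ring" by (rule poly_ring_cring)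
  interpret Pm: cring "poly_ring m :: 'k mpol ring" by (rule poly_ring_cring)
  interpret h: ring_hom_ring "poly_ring n" "poly_ring m :: 'k mpol ring" "toric_map n c"
    by (rule ring_hom_ringI2[OF P.ring_axioms Pm.ring_axioms toric_map_hom_poly_ring])
  have one_G: "1 \<in> ?G" and zero_G: "0 \<in> ?G"
    and mult_G: "\<And>x y. x \<in> ?G \<Longrightarrow> y \<in> ?G \<Longrightarrow> x * y \<in> ?G"
    and add_G: "\<And>x y. x \<in> ?G \<Longrightarrow> y \<in> ?G \<Longrightarrow> x + y \<in> ?G"
    using subringE(2,3,6,7)[OF subring_toric_gens] by simp_all
  have "?G \<subseteq> toric_map n c ` carrier (poly_ring n :: 'k mpol ring)"
  proof (rule Pm.generate_ring_min_subring1[OF toric_gens_carrier])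
    show "subring (toric_map n c ` carrier (poly_ring n)) (poly_ring m :: 'k mpol ring)"
      by (rule h.img_is_subring[OF P.carrier_is_subring])
    have "const_of r \<in> toric_map n c ` carrier (poly_ring n :: 'k mpol ring)" for r :: 'k
      by (rule image_eqI[of _ _ "Poly_Mapping.single 0 r"])
        (auto simp: toric_map_single toric_expo_0 const_of_def term_of_def carrier_poly_ring_iff)
    moreover have "monomial_of (c j) \<in> toric_map n c ` carrier (poly_ring n :: 'k mpol ring)"
      if "j < n" for j
      \<comment> \<open>The preimage is the variable with index \<open>j\<close>.\<close>
      by (rule image_eqI[of _ _ "Poly_Mapping.single (Poly_Mapping.single j 1) 1"])
        (use that in \<open>auto simp: toric_map_single toric_expo_single monomial_of_def term_of_def
          carrier_poly_ring_iff simp del: One_nat_def\<close>)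
    ultimately show "toric_gens \<subseteq> toric_map n c ` carrier (poly_ring n :: 'k mpol ring)" by blast
  qed
  moreover have "toric_map n c f \<in> ?G" for f :: "'k mpol"
  proof -
    have pow: "x ^ k \<in> ?G" if "x \<in> ?G" for x k
      using that by (induction k) (auto intro: one_G mult_G)
    have prod: "prod F A \<in> ?G" if "\<And>x. x \<in> A \<Longrightarrow> F x \<in> ?G" for F and A :: "nat set"
      using that by (induction A rule: infinite_finite_induct) (auto intro: one_G mult_G)
    have sum: "sum F A \<in> ?G" if "\<And>x. x \<in> A \<Longrightarrow> F x \<in> ?G" for F and A :: "expo set"
      using that by (induction A rule: infinite_finite_induct) (auto intro: zero_G add_G)
    show ?thesis
      unfolding toric_map_def
      by (intro sum mult_G prod pow) (auto intro: generate_ring.incl)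
  qed
  ultimately show ?thesis by (auto simp: toric_ring_def)
qed

lemma toric_ring_simps:
  "mult (toric_ring m n c) = (*)" "one (toric_ring m n c) = 1" "zero (toric_ring m n c) = 0"
  "add (toric_ring m n c) = (+)"
  by (simp_all add: toric_ring_def)

text \<open>Narrows the codomain from \<open>poly_ring m\<close> to the toric ring, onto which the
  map is surjective; the isomorphism theorem is applied in this form.\<close>

lemma toric_map_ring_hom_ring:
  "ring_hom_ring (poly_ring n) (toric_ring m n c :: 'k::field mpol ring) (toric_map n c)"
proof (rule ring_hom_ringI2)
  show "toric_map n c \<in> ring_hom (poly_ring n) (toric_ring m n c :: 'k mpol ring)"
    using ring_hom_memE[OF toric_map_hom_poly_ring, where ?'k1 = 'k] toric_map_image
    by (intro ring_hom_memI) (auto simp: toric_ring_simps toric_map_add toric_map_mult)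
qed (use poly_ring_cring toric_ring_cring cring.axioms(1) in blast)+

lemma mem_toric_ideal_iff:
  "f \<in> toric_ideal m n c \<longleftrightarrow> f \<in> carrier (poly_ring n) \<and> toric_map n c f = 0"
  by (auto simp: toric_ideal_def a_kernel_def' toric_ring_simps)

text \<open>Two exponents of the leading part are both maximal in \<open>f\<close>, so neither lies
  below the other and their degrees agree. If the leading part is zero, any \<open>d\<close> will
  do.\<close>

lemma leading_part_homogeneous:
  "\<exists>d. \<forall>a\<in>Poly_Mapping.keys (leading_part (toric_less m n c) f). toric_expo n c a = d"
  unfolding leading_part_eq_mpol_part keys_mpol_part
  using toric_expo_eq_if_not_less[of n c m, OF keys_c] by blast

text \<open>A homogeneous polynomial is its own component, so \<open>toric_map_fibre\<close>
  applies. The scalar \<open>r\<close> is zero if the terms cancel under the map.\<close>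

lemma toric_map_leading_part:
  "\<exists>d r. toric_map n c (leading_part (toric_less m n c) f) = Poly_Mapping.single d r"
proof -
  obtain d where "\<forall>a\<in>Poly_Mapping.keys (leading_part (toric_less m n c) f). toric_expo n c a = d"
    using leading_part_homogeneous by blast
  then have "mpol_part (\<lambda>a. toric_expo n c a = d) (leading_part (toric_less m n c) f)
      = leading_part (toric_less m n c) f"
    by (intro mpol_part_id) auto
  then show ?thesis using toric_map_fibre[of n c d] by metis
qed

section \<open>The leading ideal of an ideal of \<open>k[X]\<close>\<close>

context
  fixes I :: "'k::field mpol set"
  assumes ideal_I: "ideal I (poly_ring n)"
begin

lemma leading_parts_carrier: "leading_part prec ` I \<subseteq> carrier (poly_ring n)"
  using ideal.Icarr[OF ideal_I] mpol_part_carrier by (auto simp: leading_part_eq_mpol_part)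

lemma ideal_leading_ideal: "ideal (leading_ideal prec n I) (poly_ring n)"
  unfolding leading_ideal_def
  by (rule ring.genideal_ideal[OF cring.axioms(1)[OF poly_ring_cring] leading_parts_carrier])

lemma leading_part_mem_leading_ideal: "f \<in> I \<Longrightarrow> leading_part prec f \<in> leading_ideal prec n I"
  unfolding leading_ideal_def
  using ring.genideal_self[OF cring.axioms(1)[OF poly_ring_cring] leading_parts_carrier] by blast

lemma toric_ideal_subset_leading_ideal:
  assumes "toric_ideal m n c \<subseteq> I"
  shows "toric_ideal m n c \<subseteq> leading_ideal (toric_less m n c) n I"
proof
  fix f :: "'k mpol" assume f: "f \<in> toric_ideal m n c"
  let ?part = "\<lambda>d. mpol_part (\<lambda>a. toric_expo n c a = d) f"
  have "?part d \<in> leading_ideal (toric_less m n c) n I" for d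
  proof -
    \<comment> \<open>The image of this component is the term of \<open>toric_map n c f = 0\<close>
      at \<open>d\<close>, hence zero.\<close>
    have "?part d \<in> toric_ideal m n c"
      using f by (simp add: mem_toric_ideal_iff mpol_part_carrier toric_map_fibre)
    moreover have "leading_part (toric_less m n c) (?part d) = ?part d"
      unfolding leading_part_eq_mpol_part
      by (rule mpol_part_id) (auto simp: keys_mpol_part not_toric_less_if_toric_expo_eq)
    ultimately show ?thesis
      using leading_part_mem_leading_ideal assms by (metis subsetD)
  qed
  then have "(\<Sum>d\<in>toric_expo n c ` Poly_Mapping.keys f. ?part d)
      \<in> leading_ideal (toric_less m n c) n I"
    by (intro sum_mem_ideal[OF ideal_leading_ideal])
  then show "f \<in> leading_ideal (toric_less m n c) n I" by (simp add: sum_mpol_part_fibres)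
qed

text \<open>The polynomials sent into the ideal generated by the monomials of the image form an
  ideal of \<open>k[X]\<close>. It therefore contains the whole leading ideal as soon as it contains
  the leading parts of the elements of \<open>I\<close>.\<close>

lemma monomial_ideal_image_leading_ideal:
  "monomial_ideal (toric_ring m n c) (toric_map n c ` leading_ideal (toric_less m n c) n I)"
proof -
  let ?R = "toric_ring m n c :: 'k mpol ring" and ?L = "leading_ideal (toric_less m n c) n I"
  \<comment> \<open>All monomials lying in the image serve as generators.\<close>
  let ?S = "toric_map n c ` ?L \<inter> monomial_of ` UNIV"
  interpret h: ring_hom_ring "poly_ring n" ?R "toric_map n c" by (rule toric_map_ring_hom_ring)
  have J: "ideal (toric_map n c ` ?L) ?R"
    by (rule h.ideal_image[OF ideal_leading_ideal toric_map_image])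
  have S: "?S \<subseteq> carrier ?R" using ideal.Icarr[OF J] by blast
  have const: "const_of r \<in> carrier ?R" for r
    unfolding toric_ring_def by (auto intro: generate_ring.incl)
  interpret K: ideal "Idl\<^bsub>?R\<^esub> ?S" ?R by (rule h.S.genideal_ideal[OF S])
  have "leading_part (toric_less m n c) f \<in>
      {g \<in> carrier (poly_ring n). toric_map n c g \<in> Idl\<^bsub>?R\<^esub> ?S}" if "f \<in> I" for f
  proof -
    let ?g = "leading_part (toric_less m n c) f"
    have gL: "?g \<in> ?L" by (rule leading_part_mem_leading_ideal[OF that])
    obtain d r where dr: "toric_map n c ?g = Poly_Mapping.single d r"
      using toric_map_leading_part by blast
    have "toric_map n c ?g \<in> Idl\<^bsub>?R\<^esub> ?S"
    proof (cases "r = 0")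
      case True
      then show ?thesis using dr K.zero_closed by (simp add: toric_ring_simps)
    next
      case False
      \<comment> \<open>Dividing by the nonzero scalar \<open>r\<close> shows that the bare monomial
        lies in the image, hence in \<open>?S\<close>; multiplying by \<open>r\<close> afterwards
        recovers the image of \<open>?g\<close>.\<close>
      have "const_of (1 / r) * toric_map n c ?g \<in> toric_map n c ` ?L"
        using ideal.I_l_closed[OF J imageI[OF gL] const] by (simp add: toric_ring_simps)
      then have "monomial_of d \<in> toric_map n c ` ?L"
        using False by (simp add: dr const_of_def monomial_of_def term_of_def mult_single)
      then have "monomial_of d \<in> Idl\<^bsub>?R\<^esub> ?S" using h.S.genideal_self[OF S] by blast
      then have "const_of r * monomial_of d \<in> Idl\<^bsub>?R\<^esub> ?S"
        using K.I_l_closed const by (simp add: toric_ring_simps)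
      then show ?thesis by (simp add: dr const_of_def monomial_of_def term_of_def mult_single)
    qed
    then show ?thesis using gL ideal.Icarr[OF ideal_leading_ideal] by blast
  qed
  then have "Idl\<^bsub>poly_ring n\<^esub> (leading_part (toric_less m n c) ` I) \<subseteq>
      {g \<in> carrier (poly_ring n). toric_map n c g \<in> Idl\<^bsub>?R\<^esub> ?S}"
    by (intro h.R.genideal_minimal h.ideal_vimage[OF K.ideal_axioms]) blast
  then have "?L \<subseteq> {g. toric_map n c g \<in> Idl\<^bsub>?R\<^esub> ?S}"
    by (subst leading_ideal_def) blast
  then have "toric_map n c ` ?L \<subseteq> Idl\<^bsub>?R\<^esub> ?S" by blast
  moreover have "Idl\<^bsub>?R\<^esub> ?S \<subseteq> toric_map n c ` ?L" by (rule h.S.genideal_minimal[OF J]) blast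
  ultimately show ?thesis using J S unfolding monomial_ideal_def by blast
qed

end

end

theorem proposition1p7:
  fixes m n :: nat
    and c :: "nat \<Rightarrow> expo"
    and I :: "'k::field mpol set"
  assumes "\<And>j. j < n \<Longrightarrow> Poly_Mapping.keys (c j) \<subseteq> {..<m}"
    and "ideal I (poly_ring n)"
    and "toric_ideal m n c \<subseteq> I"
  shows "toric_ideal m n c \<subseteq> leading_ideal (toric_less m n c) n I \<and>
    (\<exists>J. monomial_ideal (toric_ring m n c) J \<and>
      is_module_iso (poly_ring n Quot toric_ideal m n c)
        (quotient_module (poly_ring n) (toric_ideal m n c)
          (leading_ideal (toric_less m n c) n I))
        (restrict_scalars (induced_map n c) (ideal_module (toric_ring m n c) J)))"
proof -
  let ?L = "leading_ideal (toric_less m n c) n I"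
  have sub: "toric_ideal m n c \<subseteq> ?L"
    by (rule toric_ideal_subset_leading_ideal[OF assms])
  \<comment> \<open>The witness for \<open>J\<close> is the image of the leading ideal under the
    substitution map.\<close>
  have "monomial_ideal (toric_ring m n c) (toric_map n c ` ?L)"
    by (rule monomial_ideal_image_leading_ideal[OF assms(1,2)])
  moreover have "is_module_iso (poly_ring n Quot toric_ideal m n c)
      (quotient_module (poly_ring n) (toric_ideal m n c) ?L)
      (restrict_scalars (induced_map n c) (ideal_module (toric_ring m n c) (toric_map n c ` ?L)))"
    \<comment> \<open>By definition the toric ideal is the kernel of \<open>toric_map n c\<close>,
      and \<open>induced_map n c\<close> is the map on cosets used in the general
      isomorphism.\<close>
    using ring_hom_ring.quotient_module_iso_image[OF toric_map_ring_hom_ring[OF assms(1)]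
        poly_ring_cring toric_ring_cring[OF assms(1)] toric_map_image[OF assms(1)]
        ideal_leading_ideal[OF assms(1,2)]]
    unfolding toric_ideal_def induced_map_def[abs_def] .
  ultimately show ?thesis using sub by blast
qed

end
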